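(* Let $k$ be a commutative unital ring. There is a category isomorphism $M\colon k\text{-}\mathsf{Alg}_{wa}\to k\text{-}\mathsf{BFAlg}_c$ of the category $k\text{-}\mathsf{Alg}_{wa}$ of $k$-algebras with a weak augmentation and the category $k\text{-}\mathsf{BFAlg}_c$ of unital $k$-algebras with a compatible bilinear form. This functor $M$ associates with any $k$-algebra $(A,\varepsilon_A)$ with a weak augmentation the $k$-algebra $(A,b_A)$ with compatible bilinear form $b_A:=\varepsilon_A\circ\mu_A$. Here $\mu_A\colon A\times A\to A$ is the multiplication of the algebra $A$. The quasi-inverse functor of $M$ associates with any $k$-algebra $(A,b_A)$ with identity $1_A$ and a compatible bilinear form $b_A$ the algebra with weak augmentation $(A,\varepsilon_A)$, where $\varepsilon_A\colon A\to k$ is defined by $\varepsilon_A(a)=b_A(a,1_A)$ for every $a\in A$.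
   Context: Let $k$ be a commutative ring with identity $1$. A $k$-algebra is a $k$-module $R$ with a $k$-bilinear multiplication $R\times R\to R$ (not necessarily associative, commutative or unital). A $k$-algebra morphism is a $k$-module morphism preserving multiplication. A $k$-algebra $A$ is unital if it has an element $1_A$ (its identity) with $a1_A=1_Aa=a$ for all $a\in A$; a morphism of unital $k$-algebras is a $k$-algebra morphism $f\colon A\to B$ with $f(1_A)=1_B$. For a unital $k$-algebra $A$, $\varphi_{1_A}\colon k\to A$ denotes the morphism $\lambda\mapsto\lambda 1_A$. The category $k\text{-}\mathsf{Alg}_{wa}$ has as objects all pairs $(A,\varepsilon_A)$ where $A$ is a unital $k$-algebra and $\varepsilon_A\colon A\to k$ is a weak augmentation, that is, a $k$-module morphism that is a left inverse of $\varphi_{1_A}$ (i.e. $\varepsilon_A\circ\varphi_{1_A}=\mathrm{id}_k$). Its morphisms $f\colon(A,\varepsilon_A)\to(B,\varepsilon_B)$ are the morphisms $f\colon A\to B$ of unital $k$-algebras such that $\varepsilon_Bf=\varepsilon_A$. A $k$-bilinear form $b\colon A\times A\to k$ on a $k$-algebra $A$ is compatible with the multiplication of $A$ if, for every $x,y,z,w\in A$, $xy=zw$ implies $b(x,y)=b(z,w)$. The category $k\text{-}\mathsf{BFAlg}_1$ of unital $k$-algebras with a bilinear form has as objects all pairs $(A,b_A)$ where $A$ is a unital $k$-algebra and $b_A\colon A\times A\to k$ is a $k$-bilinear mapping; its morphisms $\varphi\colon(A,b_A)\to(B,b_B)$ are the morphisms $\varphi\colon A\to B$ of unital $k$-algebras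 such that $b_A(x,y)=b_B(\varphi(x),\varphi(y))$ for every $x,y\in A$. The category $k\text{-}\mathsf{BFAlg}_c$ is the full subcategory of $k\text{-}\mathsf{BFAlg}_1$ whose objects are all unital $k$-algebras $(A,b_A)$ whose bilinear form $b_A$ is compatible with the multiplication of $A$.
   Formalization: The isomorphism is proved onto the full subcategory of compatible forms with b_A(1_A,1_A)=1; without this the claim fails for k≠0, since the zero form on A=k is compatible but a↦b_A(a,1_A)=0 is not a weak augmentation. M is also shown to be a functor into all of k-BFAlg_c. *)

theory Defs
  imports "HOL-Algebra.Module"
begin

section \<open>Categories, functors, isomorphisms of categories\<close>

text \<open>Hom-sets are indexed by domain and codomain and need not be disjoint;
  \<open>Comp C X Y Z g f\<close> is the composite of \<open>f : X \<rightarrow> Y\<close> and \<open>g : Y \<rightarrow> Z\<close>.\<close>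

record ('o, 'm) category =
  Ob :: "'o set"
  Hom :: "'o \<Rightarrow> 'o \<Rightarrow> 'm set"
  Ident :: "'o \<Rightarrow> 'm"
  Comp :: "'o \<Rightarrow> 'o \<Rightarrow> 'o \<Rightarrow> 'm \<Rightarrow> 'm \<Rightarrow> 'm"

locale category =
  fixes C :: "('o, 'm) category"
  assumes Ident_in_Hom: "X \<in> Ob C \<Longrightarrow> Ident C X \<in> Hom C X X"
    and Comp_in_Hom: "\<lbrakk>X \<in> Ob C; Y \<in> Ob C; Z \<in> Ob C; f \<in> Hom C X Y; g \<in> Hom C Y Z\<rbrakk>
      \<Longrightarrow> Comp C X Y Z g f \<in> Hom C X Z"
    and Comp_Ident: "\<lbrakk>X \<in> Ob C; Y \<in> Ob C; f \<in> Hom C X Y\<rbrakk> \<Longrightarrow> Comp C X X Y f (Ident C X) = f"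
    and Ident_Comp: "\<lbrakk>X \<in> Ob C; Y \<in> Ob C; f \<in> Hom C X Y\<rbrakk> \<Longrightarrow> Comp C X Y Y (Ident C Y) f = f"
    and Comp_assoc: "\<lbrakk>W \<in> Ob C; X \<in> Ob C; Y \<in> Ob C; Z \<in> Ob C;
        f \<in> Hom C W X; g \<in> Hom C X Y; h \<in> Hom C Y Z\<rbrakk>
      \<Longrightarrow> Comp C W Y Z h (Comp C W X Y g f) = Comp C W X Z (Comp C X Y Z h g) f"

locale cat_functor = C: category C + D: category D
  for C :: "('o1, 'm1) category" and D :: "('o2, 'm2) category" +
  fixes Fo :: "'o1 \<Rightarrow> 'o2" and Fm :: "'o1 \<Rightarrow> 'o1 \<Rightarrow> 'm1 \<Rightarrow> 'm2"
  assumes Fo_in_Ob: "X \<in> Ob C \<Longrightarrow> Fo X \<in> Ob D"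
    and Fm_in_Hom: "\<lbrakk>X \<in> Ob C; Y \<in> Ob C; f \<in> Hom C X Y\<rbrakk> \<Longrightarrow> Fm X Y f \<in> Hom D (Fo X) (Fo Y)"
    and Fm_Ident: "X \<in> Ob C \<Longrightarrow> Fm X X (Ident C X) = Ident D (Fo X)"
    and Fm_Comp: "\<lbrakk>X \<in> Ob C; Y \<in> Ob C; Z \<in> Ob C; f \<in> Hom C X Y; g \<in> Hom C Y Z\<rbrakk>
      \<Longrightarrow> Fm X Z (Comp C X Y Z g f) = Comp D (Fo X) (Fo Y) (Fo Z) (Fm Y Z g) (Fm X Y f)"

text \<open>An isomorphism of categories, in the strict sense: both composites of the functors
  \<open>(Fo, Fm)\<close> and \<open>(Go, Gm)\<close> are equal to the identity functors.\<close>

locale category_isomorphism = F: cat_functor C D Fo Fm + G: cat_functor D C Go Gm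
  for C :: "('o1, 'm1) category" and D :: "('o2, 'm2) category"
    and Fo :: "'o1 \<Rightarrow> 'o2" and Fm :: "'o1 \<Rightarrow> 'o1 \<Rightarrow> 'm1 \<Rightarrow> 'm2"
    and Go :: "'o2 \<Rightarrow> 'o1" and Gm :: "'o2 \<Rightarrow> 'o2 \<Rightarrow> 'm2 \<Rightarrow> 'm1" +
  assumes Go_Fo: "X \<in> Ob C \<Longrightarrow> Go (Fo X) = X"
    and Fo_Go: "U \<in> Ob D \<Longrightarrow> Fo (Go U) = U"
    and Gm_Fm: "\<lbrakk>X \<in> Ob C; Y \<in> Ob C; f \<in> Hom C X Y\<rbrakk> \<Longrightarrow> Gm (Fo X) (Fo Y) (Fm X Y f) = f"
    and Fm_Gm: "\<lbrakk>U \<in> Ob D; V \<in> Ob D; g \<in> Hom D U V\<rbrakk> \<Longrightarrow> Fm (Go U) (Go V) (Gm U V g) = g"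

definition full_subcategory :: "('o, 'm) category \<Rightarrow> ('o \<Rightarrow> bool) \<Rightarrow> ('o, 'm) category" where
  "full_subcategory C P = C\<lparr>Ob := {X \<in> Ob C. P X}\<rparr>"


section \<open>Nonassociative algebras\<close>

text \<open>The records of type \<^typ>\<open>('k, 'a) module\<close> carry the fields \<open>mult\<close> and \<open>one\<close>, on which
  the locale \<^locale>\<open>module\<close> imposes no condition, so they can hold an arbitrary bilinear
  multiplication and its identity.\<close>

definition module_hom ::
  "('k, 'r) ring_scheme \<Rightarrow> ('k, 'a, 'm) module_scheme \<Rightarrow> ('k, 'b, 'n) module_scheme \<Rightarrow> ('a \<Rightarrow> 'b) set"
where
  "module_hom k M N = {f \<in> carrier M \<rightarrow> carrier N.
     (\<forall>x \<in> carrier M. \<forall>y \<in> carrier M. f (x \<oplus>\<^bsub>M\<^esub> y) = f x \<oplus>\<^bsub>N\<^esub> f y) \<and>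
     (\<forall>r \<in> carrier k. \<forall>x \<in> carrier M. f (r \<odot>\<^bsub>M\<^esub> x) = r \<odot>\<^bsub>N\<^esub> f x)}"

definition bilinear_maps ::
  "('k, 'r) ring_scheme \<Rightarrow> ('k, 'a, 'm) module_scheme \<Rightarrow> ('k, 'b, 'n) module_scheme
    \<Rightarrow> ('k, 'c, 'p) module_scheme \<Rightarrow> ('a \<times> 'b \<Rightarrow> 'c) set"
where
  "bilinear_maps k M N P = {b.
     (\<forall>x \<in> carrier M. (\<lambda>y. b (x, y)) \<in> module_hom k N P) \<and>
     (\<forall>y \<in> carrier N. (\<lambda>x. b (x, y)) \<in> module_hom k M P)}"

definition self_module :: "('k, 'r) ring_scheme \<Rightarrow> ('k, 'k) module" where
  "self_module k = \<lparr>carrier = carrier k, mult = mult k, one = one k,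
     zero = zero k, add = add k, smult = mult k\<rparr>"

definition mult_map :: "('k, 'a) module \<Rightarrow> 'a \<times> 'a \<Rightarrow> 'a" where
  "mult_map A = (\<lambda>(x, y). x \<otimes>\<^bsub>A\<^esub> y)"

locale k_algebra = module k A for k :: "('k, 'r) ring_scheme" and A :: "('k, 'a) module" +
  assumes mult_bilinear: "mult_map A \<in> bilinear_maps k A A A"

locale unital_k_algebra = k_algebra +
  assumes one_in_carrier: "\<one>\<^bsub>A\<^esub> \<in> carrier A"
    and mult_one_right: "a \<in> carrier A \<Longrightarrow> a \<otimes>\<^bsub>A\<^esub> \<one>\<^bsub>A\<^esub> = a"
    and mult_one_left: "a \<in> carrier A \<Longrightarrow> \<one>\<^bsub>A\<^esub> \<otimes>\<^bsub>A\<^esub> a = a"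

definition unital_algebra_hom ::
  "('k, 'r) ring_scheme \<Rightarrow> ('k, 'a) module \<Rightarrow> ('k, 'b) module \<Rightarrow> ('a \<Rightarrow> 'b) set"
where
  "unital_algebra_hom k A B = {f \<in> module_hom k A B.
     (\<forall>x \<in> carrier A. \<forall>y \<in> carrier A. f (x \<otimes>\<^bsub>A\<^esub> y) = f x \<otimes>\<^bsub>B\<^esub> f y) \<and>
     f \<one>\<^bsub>A\<^esub> = \<one>\<^bsub>B\<^esub>}"

definition unit_map :: "('k, 'r) ring_scheme \<Rightarrow> ('k, 'a) module \<Rightarrow> 'k \<Rightarrow> 'a" where
  "unit_map k A = (\<lambda>r. r \<odot>\<^bsub>A\<^esub> \<one>\<^bsub>A\<^esub>)"

definition weak_augmentation ::
  "('k, 'r) ring_scheme \<Rightarrow> ('k, 'a) module \<Rightarrow> ('a \<Rightarrow> 'k) \<Rightarrow> bool"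
where
  "weak_augmentation k A \<epsilon> \<longleftrightarrow>
     \<epsilon> \<in> module_hom k A (self_module k) \<and> (\<forall>r \<in> carrier k. \<epsilon> (unit_map k A r) = r)"

definition compatible_form :: "('k, 'a) module \<Rightarrow> ('a \<times> 'a \<Rightarrow> 'k) \<Rightarrow> bool" where
  "compatible_form A b \<longleftrightarrow> (\<forall>x \<in> carrier A. \<forall>y \<in> carrier A. \<forall>z \<in> carrier A. \<forall>w \<in> carrier A.
     x \<otimes>\<^bsub>A\<^esub> y = z \<otimes>\<^bsub>A\<^esub> w \<longrightarrow> b (x, y) = b (z, w))"


section \<open>The categories\<close>

text \<open>Maps defined on a carrier are represented by functions in \<^const>\<open>extensional\<close>, so that
  equality of objects and of morphisms is equality of the mathematical maps.\<close>

definition Alg_wa ::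
  "('k, 'r) ring_scheme \<Rightarrow> (('k, 'a) module \<times> ('a \<Rightarrow> 'k), 'a \<Rightarrow> 'a) category"
where
  "Alg_wa k = \<lparr>
     Ob = {(A, \<epsilon>). unital_k_algebra k A \<and> weak_augmentation k A \<epsilon> \<and> \<epsilon> \<in> extensional (carrier A)},
     Hom = (\<lambda>(A, \<epsilon>\<^sub>A) (B, \<epsilon>\<^sub>B). {f \<in> unital_algebra_hom k A B \<inter> extensional (carrier A).
       \<forall>x \<in> carrier A. \<epsilon>\<^sub>B (f x) = \<epsilon>\<^sub>A x}),
     Ident = (\<lambda>(A, _). \<lambda>x \<in> carrier A. x),
     Comp = (\<lambda>(A, _) _ _ g f. compose (carrier A) g f)\<rparr>"

definition BFAlg_1 ::
  "('k, 'r) ring_scheme \<Rightarrow> (('k, 'a) module \<times> ('a \<times> 'a \<Rightarrow> 'k), 'a \<Rightarrow> 'a) category"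
where
  "BFAlg_1 k = \<lparr>
     Ob = {(A, b). unital_k_algebra k A \<and> b \<in> bilinear_maps k A A (self_module k) \<and>
       b \<in> extensional (carrier A \<times> carrier A)},
     Hom = (\<lambda>(A, b\<^sub>A) (B, b\<^sub>B). {f \<in> unital_algebra_hom k A B \<inter> extensional (carrier A).
       \<forall>x \<in> carrier A. \<forall>y \<in> carrier A. b\<^sub>A (x, y) = b\<^sub>B (f x, f y)}),
     Ident = (\<lambda>(A, _). \<lambda>x \<in> carrier A. x),
     Comp = (\<lambda>(A, _) _ _ g f. compose (carrier A) g f)\<rparr>"

definition BFAlg_c ::
  "('k, 'r) ring_scheme \<Rightarrow> (('k, 'a) module \<times> ('a \<times> 'a \<Rightarrow> 'k), 'a \<Rightarrow> 'a) category"
where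
  "BFAlg_c k = full_subcategory (BFAlg_1 k) (\<lambda>(A, b). compatible_form A b)"


section \<open>The functors\<close>

definition M_obj :: "('k, 'a) module \<times> ('a \<Rightarrow> 'k) \<Rightarrow> ('k, 'a) module \<times> ('a \<times> 'a \<Rightarrow> 'k)" where
  "M_obj = (\<lambda>(A, \<epsilon>). (A, compose (carrier A \<times> carrier A) \<epsilon> (mult_map A)))"

definition M_mor ::
  "('k, 'a) module \<times> ('a \<Rightarrow> 'k) \<Rightarrow> ('k, 'a) module \<times> ('a \<Rightarrow> 'k) \<Rightarrow> ('a \<Rightarrow> 'a) \<Rightarrow> 'a \<Rightarrow> 'a"
where
  "M_mor X Y f = f"

definition N_obj :: "('k, 'a) module \<times> ('a \<times> 'a \<Rightarrow> 'k) \<Rightarrow> ('k, 'a) module \<times> ('a \<Rightarrow> 'k)" where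
  "N_obj = (\<lambda>(A, b). (A, \<lambda>a \<in> carrier A. b (a, \<one>\<^bsub>A\<^esub>)))"

definition N_mor ::
  "('k, 'a) module \<times> ('a \<times> 'a \<Rightarrow> 'k) \<Rightarrow> ('k, 'a) module \<times> ('a \<times> 'a \<Rightarrow> 'k)
    \<Rightarrow> ('a \<Rightarrow> 'a) \<Rightarrow> 'a \<Rightarrow> 'a"
where
  "N_mor X Y f = f"


section \<open>Normalised forms\<close>

text \<open>The assignment \<^const>\<open>N_obj\<close> produces a weak augmentation only if \<open>b (1, 1) = 1\<close>, which
  compatibility alone does not give: the zero form is compatible with every multiplication.
  Hence the isomorphism has to be stated for the full subcategory of \<^const>\<open>BFAlg_c\<close> on the
  normalised forms, as the following lemmas show.\<close>

definition normalised_form ::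
  "('k, 'r) ring_scheme \<Rightarrow> ('k, 'a) module \<Rightarrow> ('a \<times> 'a \<Rightarrow> 'k) \<Rightarrow> bool"
where
  "normalised_form k A b \<longleftrightarrow> b (\<one>\<^bsub>A\<^esub>, \<one>\<^bsub>A\<^esub>) = \<one>\<^bsub>k\<^esub>"

lemma N_obj_in_Alg_wa_iff:
  assumes "(A, b) \<in> Ob (BFAlg_c k)"
  shows "N_obj (A, b) \<in> Ob (Alg_wa k) \<longleftrightarrow> normalised_form k A b"
proof -
  have ua: "unital_k_algebra k A" and b: "b \<in> bilinear_maps k A A (self_module k)"
    using assms by (auto simp: BFAlg_c_def BFAlg_1_def full_subcategory_def)
  interpret unital_k_algebra k A by (rule ua)
  have hom: "(\<lambda>a. b (a, \<one>\<^bsub>A\<^esub>)) \<in> module_hom k A (self_module k)"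
    using b one_in_carrier by (auto simp: bilinear_maps_def)
  then have "(\<lambda>a \<in> carrier A. b (a, \<one>\<^bsub>A\<^esub>)) \<in> module_hom k A (self_module k)"
    by (auto simp: module_hom_def)
  moreover have "b (r \<odot>\<^bsub>A\<^esub> \<one>\<^bsub>A\<^esub>, \<one>\<^bsub>A\<^esub>) = r \<otimes>\<^bsub>k\<^esub> b (\<one>\<^bsub>A\<^esub>, \<one>\<^bsub>A\<^esub>)" if "r \<in> carrier k" for r
    using hom that one_in_carrier by (auto simp: module_hom_def self_module_def)
  moreover have "b (\<one>\<^bsub>A\<^esub>, \<one>\<^bsub>A\<^esub>) \<in> carrier k"
    using hom one_in_carrier by (auto simp: module_hom_def self_module_def)
  ultimately show ?thesis
    using ua one_in_carrier
    by (auto simp: N_obj_def Alg_wa_def weak_augmentation_def unit_map_def normalised_form_def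
        dest: bspec[where x = "\<one>\<^bsub>k\<^esub>"])
qed

lemma unital_k_algebra_self_module:
  assumes "cring k"
  shows "unital_k_algebra k (self_module k)"
proof -
  interpret cring k by (rule assms)
  have "abelian_group (self_module k)"
    by (rule abelian_groupI) (auto simp: self_module_def a_ac intro: l_neg a_inv_closed)
  then have "module k (self_module k)"
    by (intro moduleI assms) (auto simp: self_module_def l_distr r_distr m_assoc)
  then show ?thesis
    by (auto simp: unital_k_algebra_def unital_k_algebra_axioms_def k_algebra_def
        k_algebra_axioms_def bilinear_maps_def module_hom_def mult_map_def self_module_def
        l_distr r_distr m_assoc m_lcomm)
qed

lemma not_isomorphism_without_normalisation:
  fixes k :: "('k, 'r) ring_scheme"
  assumes "cring k" and "\<one>\<^bsub>k\<^esub> \<noteq> \<zero>\<^bsub>k\<^esub>"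
  shows "\<not> category_isomorphism
    (Alg_wa k :: (('k, 'k) module \<times> ('k \<Rightarrow> 'k), 'k \<Rightarrow> 'k) category) (BFAlg_c k) M_obj Fm Go Gm"
proof
  assume "category_isomorphism
    (Alg_wa k :: (('k, 'k) module \<times> ('k \<Rightarrow> 'k), 'k \<Rightarrow> 'k) category) (BFAlg_c k) M_obj Fm Go Gm"
  then interpret category_isomorphism
    "Alg_wa k :: (('k, 'k) module \<times> ('k \<Rightarrow> 'k), 'k \<Rightarrow> 'k) category" "BFAlg_c k" M_obj Fm Go Gm .
  interpret k: cring k by (rule assms)
  let ?A = "self_module k"
  let ?X = "(?A, \<lambda>p \<in> carrier ?A \<times> carrier ?A. \<zero>\<^bsub>k\<^esub>)"
  have X: "?X \<in> Ob (BFAlg_c k)"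
    using unital_k_algebra_self_module[OF assms(1)]
    by (auto simp: BFAlg_c_def BFAlg_1_def full_subcategory_def bilinear_maps_def module_hom_def
        compatible_form_def self_module_def)
  obtain \<epsilon> where \<epsilon>: "Go ?X = (?A, \<epsilon>)" "M_obj (?A, \<epsilon>) = ?X"
    using Fo_Go[OF X] by (cases "Go ?X") (auto simp: M_obj_def)
  have "weak_augmentation k ?A \<epsilon>"
    using G.Fo_in_Ob[OF X] unfolding \<epsilon>(1) by (auto simp: Alg_wa_def)
  then have "\<epsilon> \<one>\<^bsub>k\<^esub> = \<one>\<^bsub>k\<^esub>"
    by (auto simp: weak_augmentation_def unit_map_def self_module_def dest: bspec[where x = "\<one>\<^bsub>k\<^esub>"])
  moreover have "\<epsilon> \<one>\<^bsub>k\<^esub> = \<zero>\<^bsub>k\<^esub>"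
    using fun_cong[OF arg_cong[OF \<epsilon>(2), of snd], of "(\<one>\<^bsub>k\<^esub>, \<one>\<^bsub>k\<^esub>)"]
    by (auto simp: M_obj_def compose_def mult_map_def self_module_def)
  ultimately show False
    using assms(2) by simp
qed

end

theory Submission
  imports Defs
begin

text \<open>The bilinear form and the weak augmentation determine each other: \<open>\<epsilon> a = \<epsilon> (a 1) = b (a, 1)\<close>
  recovers \<open>\<epsilon>\<close> from \<open>b\<close>, and since \<open>x y = (x y) 1\<close>, compatibility gives
  \<open>b (x, y) = b (x y, 1) = \<epsilon> (x y)\<close>, which recovers \<open>b\<close> from \<open>\<epsilon>\<close>. On morphisms both functors
  are the identity.\<close>

section \<open>Linear maps, algebra morphisms and bilinear maps under composition\<close>

lemma module_homD:
  assumes "f \<in> module_hom k M N"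
  shows "x \<in> carrier M \<Longrightarrow> f x \<in> carrier N"
    and "\<lbrakk>x \<in> carrier M; y \<in> carrier M\<rbrakk> \<Longrightarrow> f (x \<oplus>\<^bsub>M\<^esub> y) = f x \<oplus>\<^bsub>N\<^esub> f y"
    and "\<lbrakk>r \<in> carrier k; x \<in> carrier M\<rbrakk> \<Longrightarrow> f (r \<odot>\<^bsub>M\<^esub> x) = r \<odot>\<^bsub>N\<^esub> f x"
  using assms by (auto simp: module_hom_def)

lemma unital_algebra_homD:
  assumes "f \<in> unital_algebra_hom k A B"
  shows "f \<in> module_hom k A B"
    and "x \<in> carrier A \<Longrightarrow> f x \<in> carrier B"
    and "\<lbrakk>x \<in> carrier A; y \<in> carrier A\<rbrakk> \<Longrightarrow> f (x \<otimes>\<^bsub>A\<^esub> y) = f x \<otimes>\<^bsub>B\<^esub> f y"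
    and "f \<one>\<^bsub>A\<^esub> = \<one>\<^bsub>B\<^esub>"
  using assms by (auto simp: unital_algebra_hom_def module_hom_def)

text \<open>The conditions of \<open>module_hom\<close> evaluate a map only at elements of the
  carrier, which the module axioms close under sums and scalar multiples. This lets a slice of a
  restricted composite be exchanged for a composite of slices.\<close>

lemma module_hom_cong:
  assumes "module k M" and "\<And>x. x \<in> carrier M \<Longrightarrow> f x = g x"
  shows "f \<in> module_hom k M N \<longleftrightarrow> g \<in> module_hom k M N"
proof -
  interpret module k M by (rule assms)
  show ?thesis
    using assms(2) by (auto simp: module_hom_def Pi_iff)
qed

lemma module_hom_compose:
  assumes "module k M" and "f \<in> module_hom k M N" and "g \<in> module_hom k N P"
  shows "compose (carrier M) g f \<in> module_hom k M P"
proof -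
  interpret module k M by (rule assms)
  show ?thesis
    using module_homD[OF assms(2)] module_homD[OF assms(3)]
    by (auto simp: module_hom_def compose_def)
qed

lemma (in k_algebra) mult_closed:
  assumes "x \<in> carrier A" and "y \<in> carrier A"
  shows "x \<otimes>\<^bsub>A\<^esub> y \<in> carrier A"
  using mult_bilinear assms by (auto simp: bilinear_maps_def module_hom_def mult_map_def)

lemma (in unital_k_algebra) unital_algebra_hom_id:
  "(\<lambda>x \<in> carrier A. x) \<in> unital_algebra_hom k A A"
  using one_in_carrier
  by (auto simp: unital_algebra_hom_def module_hom_def mult_closed)

lemma (in unital_k_algebra) unital_algebra_hom_compose:
  assumes f: "f \<in> unital_algebra_hom k A B" and g: "g \<in> unital_algebra_hom k B C"
  shows "compose (carrier A) g f \<in> unital_algebra_hom k A C"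
proof -
  have "compose (carrier A) g f \<in> module_hom k A C"
    using module_axioms unital_algebra_homD(1)[OF f] unital_algebra_homD(1)[OF g]
    by (rule module_hom_compose)
  then show ?thesis
    using one_in_carrier mult_closed unital_algebra_homD[OF f] unital_algebra_homD[OF g]
    by (auto simp: unital_algebra_hom_def compose_def)
qed

text \<open>Fixing one argument of the composite gives \<open>f\<close> after a linear slice of
  \<open>b\<close>, so linearity in each variable follows from \<open>module_hom_compose\<close>.
  With \<open>b\<close> the multiplication and \<open>f\<close> a weak augmentation this yields the
  form of \<open>M_obj\<close>.\<close>

lemma bilinear_maps_compose:
  assumes "module k M" and "module k N"
    and b: "b \<in> bilinear_maps k M N P" and f: "f \<in> module_hom k P Q"
  shows "compose (carrier M \<times> carrier N) f b \<in> bilinear_maps k M N Q"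
proof -
  have "(\<lambda>y. compose (carrier M \<times> carrier N) f b (x, y)) \<in> module_hom k N Q"
    if x: "x \<in> carrier M" for x
  proof -
    have "(\<lambda>y. b (x, y)) \<in> module_hom k N P"
      using b x by (auto simp: bilinear_maps_def)
    from module_hom_compose[OF assms(2) this f] show ?thesis
      using x by (subst module_hom_cong[OF assms(2)]) (auto simp: compose_def)
  qed
  moreover have "(\<lambda>x. compose (carrier M \<times> carrier N) f b (x, y)) \<in> module_hom k M Q"
    if y: "y \<in> carrier N" for y
  proof -
    have "(\<lambda>x. b (x, y)) \<in> module_hom k M P"
      using b y by (auto simp: bilinear_maps_def)
    from module_hom_compose[OF assms(1) this f] show ?thesis
      using y by (subst module_hom_cong[OF assms(1)]) (auto simp: compose_def)
  qed
  ultimately show ?thesis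
    by (auto simp: bilinear_maps_def)
qed

section \<open>Membership conditions and category axioms\<close>

lemma Alg_wa_Ob_iff:
  "(A, \<epsilon>) \<in> Ob (Alg_wa k) \<longleftrightarrow>
    unital_k_algebra k A \<and> weak_augmentation k A \<epsilon> \<and> \<epsilon> \<in> extensional (carrier A)"
  by (simp add: Alg_wa_def)

lemma Alg_wa_Hom_iff:
  "f \<in> Hom (Alg_wa k) (A, \<epsilon>\<^sub>A) (B, \<epsilon>\<^sub>B) \<longleftrightarrow>
    f \<in> unital_algebra_hom k A B \<and> f \<in> extensional (carrier A) \<and>
    (\<forall>x \<in> carrier A. \<epsilon>\<^sub>B (f x) = \<epsilon>\<^sub>A x)"
  by (simp add: Alg_wa_def)

lemma Alg_wa_simps [simp]:
  "Ident (Alg_wa k) (A, \<epsilon>) = (\<lambda>x \<in> carrier A. x)"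
  "Comp (Alg_wa k) (A, \<epsilon>) Y Z g f = compose (carrier A) g f"
  by (simp_all add: Alg_wa_def)

lemma BFAlg_1_Ob_iff:
  "(A, b) \<in> Ob (BFAlg_1 k) \<longleftrightarrow>
    unital_k_algebra k A \<and> b \<in> bilinear_maps k A A (self_module k) \<and>
    b \<in> extensional (carrier A \<times> carrier A)"
  by (simp add: BFAlg_1_def)

lemma BFAlg_1_Hom_iff:
  "f \<in> Hom (BFAlg_1 k) (A, b\<^sub>A) (B, b\<^sub>B) \<longleftrightarrow>
    f \<in> unital_algebra_hom k A B \<and> f \<in> extensional (carrier A) \<and>
    (\<forall>x \<in> carrier A. \<forall>y \<in> carrier A. b\<^sub>A (x, y) = b\<^sub>B (f x, f y))"
  by (simp add: BFAlg_1_def)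

lemma BFAlg_1_simps [simp]:
  "Ident (BFAlg_1 k) (A, b) = (\<lambda>x \<in> carrier A. x)"
  "Comp (BFAlg_1 k) (A, b) Y Z g f = compose (carrier A) g f"
  by (simp_all add: BFAlg_1_def)

lemma full_subcategory_simps [simp]:
  "X \<in> Ob (full_subcategory C P) \<longleftrightarrow> X \<in> Ob C \<and> P X"
  "Hom (full_subcategory C P) = Hom C"
  "Ident (full_subcategory C P) = Ident C"
  "Comp (full_subcategory C P) = Comp C"
  by (simp_all add: full_subcategory_def)

lemma category_full_subcategory:
  assumes "category C"
  shows "category (full_subcategory C P)"
proof -
  interpret category C by (rule assms)
  show ?thesis
    by unfold_locales (auto simp: Ident_in_Hom Comp_in_Hom Comp_Ident Ident_Comp Comp_assoc)
qed

text \<open>Extensionality makes the identity laws strict equalities: off \<open>S\<close> both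
  sides are \<open>undefined\<close>.\<close>

lemma compose_restrict_id_right:
  "f \<in> extensional S \<Longrightarrow> compose S f (\<lambda>x \<in> S. x) = f"
  by (auto simp: compose_def extensional_def fun_eq_iff)

lemma compose_restrict_id_left:
  "\<lbrakk>f \<in> extensional S; f \<in> S \<rightarrow> T\<rbrakk> \<Longrightarrow> compose S (\<lambda>x \<in> T. x) f = f"
  by (auto simp: compose_def extensional_def fun_eq_iff)

lemma category_Alg_wa: "category (Alg_wa k)"
proof
  fix X :: "('b, 'a) module \<times> ('a \<Rightarrow> 'b)"
  assume "X \<in> Ob (Alg_wa k)"
  then show "Ident (Alg_wa k) X \<in> Hom (Alg_wa k) X X"
    by (cases X) (auto simp: Alg_wa_Ob_iff Alg_wa_Hom_iff
        intro: unital_k_algebra.unital_algebra_hom_id)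
next
  fix X Y Z :: "('b, 'a) module \<times> ('a \<Rightarrow> 'b)" and f g
  assume "X \<in> Ob (Alg_wa k)" and "Y \<in> Ob (Alg_wa k)" and "Z \<in> Ob (Alg_wa k)"
    and "f \<in> Hom (Alg_wa k) X Y" and "g \<in> Hom (Alg_wa k) Y Z"
  then show "Comp (Alg_wa k) X Y Z g f \<in> Hom (Alg_wa k) X Z"
    by (cases X; cases Y; cases Z)
      (auto simp: Alg_wa_Ob_iff Alg_wa_Hom_iff unital_algebra_homD(2) compose_eq
        intro: unital_k_algebra.unital_algebra_hom_compose)
next
  fix X Y :: "('b, 'a) module \<times> ('a \<Rightarrow> 'b)" and f
  assume "f \<in> Hom (Alg_wa k) X Y"
  then show "Comp (Alg_wa k) X X Y f (Ident (Alg_wa k) X) = f"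
    and "Comp (Alg_wa k) X Y Y (Ident (Alg_wa k) Y) f = f"
    by (cases X; cases Y; auto simp: Alg_wa_Hom_iff unital_algebra_homD(2)
        compose_restrict_id_right intro!: compose_restrict_id_left)+
next
  fix W X Y Z :: "('b, 'a) module \<times> ('a \<Rightarrow> 'b)" and f g h
  assume "f \<in> Hom (Alg_wa k) W X"
  then show "Comp (Alg_wa k) W Y Z h (Comp (Alg_wa k) W X Y g f) =
      Comp (Alg_wa k) W X Z (Comp (Alg_wa k) X Y Z h g) f"
    by (cases W; cases X) (auto simp: Alg_wa_Hom_iff unital_algebra_homD(2) intro!: compose_assoc)
qed

text \<open>The argument is the one for \<open>Alg_wa\<close>, with preservation of forms in place
  of preservation of augmentations.\<close>

lemma category_BFAlg_1: "category (BFAlg_1 k)"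
proof
  fix X :: "('b, 'a) module \<times> ('a \<times> 'a \<Rightarrow> 'b)"
  assume "X \<in> Ob (BFAlg_1 k)"
  then show "Ident (BFAlg_1 k) X \<in> Hom (BFAlg_1 k) X X"
    by (cases X) (auto simp: BFAlg_1_Ob_iff BFAlg_1_Hom_iff
        intro: unital_k_algebra.unital_algebra_hom_id)
next
  fix X Y Z :: "('b, 'a) module \<times> ('a \<times> 'a \<Rightarrow> 'b)" and f g
  assume "X \<in> Ob (BFAlg_1 k)" and "Y \<in> Ob (BFAlg_1 k)" and "Z \<in> Ob (BFAlg_1 k)"
    and "f \<in> Hom (BFAlg_1 k) X Y" and "g \<in> Hom (BFAlg_1 k) Y Z"
  then show "Comp (BFAlg_1 k) X Y Z g f \<in> Hom (BFAlg_1 k) X Z"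
    by (cases X; cases Y; cases Z)
      (auto simp: BFAlg_1_Ob_iff BFAlg_1_Hom_iff unital_algebra_homD(2) compose_eq
        intro: unital_k_algebra.unital_algebra_hom_compose)
next
  fix X Y :: "('b, 'a) module \<times> ('a \<times> 'a \<Rightarrow> 'b)" and f
  assume "f \<in> Hom (BFAlg_1 k) X Y"
  then show "Comp (BFAlg_1 k) X X Y f (Ident (BFAlg_1 k) X) = f"
    and "Comp (BFAlg_1 k) X Y Y (Ident (BFAlg_1 k) Y) f = f"
    by (cases X; cases Y; auto simp: BFAlg_1_Hom_iff unital_algebra_homD(2)
        compose_restrict_id_right intro!: compose_restrict_id_left)+
next
  fix W X Y Z :: "('b, 'a) module \<times> ('a \<times> 'a \<Rightarrow> 'b)" and f g h
  assume "f \<in> Hom (BFAlg_1 k) W X"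
  then show "Comp (BFAlg_1 k) W Y Z h (Comp (BFAlg_1 k) W X Y g f) =
      Comp (BFAlg_1 k) W X Z (Comp (BFAlg_1 k) X Y Z h g) f"
    by (cases W; cases X) (auto simp: BFAlg_1_Hom_iff unital_algebra_homD(2) intro!: compose_assoc)
qed

lemma category_BFAlg_c: "category (BFAlg_c k)"
  unfolding BFAlg_c_def by (intro category_full_subcategory category_BFAlg_1)

lemma BFAlg_c_Ob_iff:
  "(A, b) \<in> Ob (BFAlg_c k) \<longleftrightarrow> (A, b) \<in> Ob (BFAlg_1 k) \<and> compatible_form A b"
  by (simp add: BFAlg_c_def)

lemma BFAlg_c_simps [simp]:
  "Hom (BFAlg_c k) = Hom (BFAlg_1 k)"
  "Ident (BFAlg_c k) = Ident (BFAlg_1 k)"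
  "Comp (BFAlg_c k) = Comp (BFAlg_1 k)"
  by (simp_all add: BFAlg_c_def)

section \<open>Action of the two functors on objects and morphisms\<close>

text \<open>Bilinearity is that of the multiplication followed by a linear map. Compatibility is
  automatic, because the value of the form at \<open>(x, y)\<close> depends only on the product of
  \<open>x\<close> and \<open>y\<close>.\<close>

lemma M_obj_in_BFAlg_c:
  assumes "(A, \<epsilon>) \<in> Ob (Alg_wa k)"
  shows "M_obj (A, \<epsilon>) \<in> Ob (BFAlg_c k)"
proof -
  interpret unital_k_algebra k A
    using assms by (simp add: Alg_wa_Ob_iff)
  have "\<epsilon> \<in> module_hom k A (self_module k)"
    using assms by (simp add: Alg_wa_Ob_iff weak_augmentation_def)
  with mult_bilinear have
    "compose (carrier A \<times> carrier A) \<epsilon> (mult_map A) \<in> bilinear_maps k A A (self_module k)"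
    by (intro bilinear_maps_compose module_axioms)
  then show ?thesis
    using unital_k_algebra_axioms
    by (auto simp: M_obj_def BFAlg_c_Ob_iff BFAlg_1_Ob_iff compatible_form_def
        compose_def mult_map_def)
qed

text \<open>The value at \<open>(1, 1)\<close> is \<epsilon> of 1 times 1, that is \<epsilon> of 1,
  and a left inverse of the unit map sends the identity of \<open>A\<close> to that of
  \<open>k\<close>.\<close>

lemma normalised_form_M_obj:
  assumes "(A, \<epsilon>) \<in> Ob (Alg_wa k)"
  shows "normalised_form k A (snd (M_obj (A, \<epsilon>)))"
proof -
  interpret unital_k_algebra k A
    using assms by (simp add: Alg_wa_Ob_iff)
  \<comment> \<open>The left inverse condition is taken at the scalar 1; the module axioms then
    remove that scalar.\<close>
  have "\<epsilon> (\<one>\<^bsub>k\<^esub> \<odot>\<^bsub>A\<^esub> \<one>\<^bsub>A\<^esub>) = \<one>\<^bsub>k\<^esub>"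
    using assms by (auto simp: Alg_wa_Ob_iff weak_augmentation_def unit_map_def)
  then show ?thesis
    using one_in_carrier mult_one_left
    by (auto simp: M_obj_def normalised_form_def compose_def mult_map_def)
qed

text \<open>Multiplicativity of \<open>f\<close> moves the product inside \<open>f\<close>, where
  preservation of the augmentation applies.\<close>

lemma M_mor_in_BFAlg_c:
  assumes "(A, \<epsilon>\<^sub>A) \<in> Ob (Alg_wa k)" and "f \<in> Hom (Alg_wa k) (A, \<epsilon>\<^sub>A) (B, \<epsilon>\<^sub>B)"
  shows "f \<in> Hom (BFAlg_c k) (M_obj (A, \<epsilon>\<^sub>A)) (M_obj (B, \<epsilon>\<^sub>B))"
proof -
  interpret unital_k_algebra k A
    using assms by (simp add: Alg_wa_Ob_iff)
  have "f \<in> unital_algebra_hom k A B" and "\<forall>x \<in> carrier A. \<epsilon>\<^sub>B (f x) = \<epsilon>\<^sub>A x"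
    using assms(2) by (simp_all add: Alg_wa_Hom_iff)
  then have "\<epsilon>\<^sub>A (x \<otimes>\<^bsub>A\<^esub> y) = \<epsilon>\<^sub>B (f x \<otimes>\<^bsub>B\<^esub> f y)"
    if "x \<in> carrier A" "y \<in> carrier A" for x y
    using that mult_closed by (metis unital_algebra_homD(3))
  then show ?thesis
    using assms(2)
    by (auto simp: M_obj_def Alg_wa_Hom_iff BFAlg_1_Hom_iff compose_def mult_map_def
        unital_algebra_homD(2))
qed

text \<open>Preservation of the form is specialised to second argument 1, which \<open>f\<close>
  sends to 1.\<close>

lemma N_mor_in_Alg_wa:
  assumes "(A, b\<^sub>A) \<in> Ob (BFAlg_c k)" and "f \<in> Hom (BFAlg_c k) (A, b\<^sub>A) (B, b\<^sub>B)"
  shows "f \<in> Hom (Alg_wa k) (N_obj (A, b\<^sub>A)) (N_obj (B, b\<^sub>B))"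
proof -
  interpret unital_k_algebra k A
    using assms by (simp add: BFAlg_c_Ob_iff BFAlg_1_Ob_iff)
  show ?thesis
    using assms(2) one_in_carrier
    by (auto simp: N_obj_def Alg_wa_Hom_iff BFAlg_1_Hom_iff unital_algebra_homD(2,4))
qed

lemma N_obj_M_obj:
  assumes "(A, \<epsilon>) \<in> Ob (Alg_wa k)"
  shows "N_obj (M_obj (A, \<epsilon>)) = (A, \<epsilon>)"
proof -
  interpret unital_k_algebra k A
    using assms by (simp add: Alg_wa_Ob_iff)
  show ?thesis
    using assms one_in_carrier
    by (auto simp: N_obj_def M_obj_def Alg_wa_Ob_iff compose_def mult_map_def mult_one_right
        extensional_def fun_eq_iff)
qed

lemma M_obj_N_obj:
  assumes "(A, b) \<in> Ob (BFAlg_c k)"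
  shows "M_obj (N_obj (A, b)) = (A, b)"
proof -
  interpret unital_k_algebra k A
    using assms by (simp add: BFAlg_c_Ob_iff BFAlg_1_Ob_iff)
  \<comment> \<open>Compatibility compares two factorisations of one element: \<open>xy\<close>
    times 1, and \<open>x\<close> times \<open>y\<close>.\<close>
  have "b (x \<otimes>\<^bsub>A\<^esub> y, \<one>\<^bsub>A\<^esub>) = b (x, y)" if "x \<in> carrier A" "y \<in> carrier A" for x y
    using assms that mult_closed one_in_carrier mult_one_right
    unfolding BFAlg_c_Ob_iff compatible_form_def by metis
  then show ?thesis
    using assms
    by (auto simp: N_obj_def M_obj_def BFAlg_c_Ob_iff BFAlg_1_Ob_iff compose_def mult_map_def
        mult_closed extensional_def fun_eq_iff)
qed

section \<open>Functoriality and the isomorphism\<close>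

lemma cat_functor_M: "cat_functor (Alg_wa k) (BFAlg_c k) M_obj M_mor"
proof (intro cat_functor.intro category_Alg_wa category_BFAlg_c cat_functor_axioms.intro)
\<comment> \<open>Rewriting the hom-sets of \<open>BFAlg_c\<close> to those of
  \<open>BFAlg_1\<close> is switched off so that \<open>M_mor_in_BFAlg_c\<close> can match. The
  second \<open>auto\<close> treats identities and composites, which need \<open>M_obj\<close>
  unfolded to a pair.\<close>
qed (auto simp: M_mor_def M_obj_in_BFAlg_c M_mor_in_BFAlg_c simp del: BFAlg_c_simps(1),
    auto simp: M_obj_def)

text \<open>The source consists of the normalised forms because, by
  \<open>N_obj_in_Alg_wa_iff\<close>, these are exactly the compatible forms that
  \<open>N_obj\<close> sends into \<open>Alg_wa\<close>.\<close>

lemma cat_functor_N: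
  "cat_functor (full_subcategory (BFAlg_c k) (\<lambda>(A, b). normalised_form k A b)) (Alg_wa k)
    N_obj N_mor"
proof (intro cat_functor.intro category_full_subcategory category_Alg_wa category_BFAlg_c
    cat_functor_axioms.intro)
qed (auto simp: N_mor_def N_obj_in_Alg_wa_iff N_mor_in_Alg_wa simp del: BFAlg_c_simps(1),
    auto simp: N_obj_def)

text \<open>Passing to a full subcategory changes only the objects, so the functor laws carry over.
  This moves the target of \<open>M_obj\<close> to the normalised forms, where it meets the source
  of \<open>N_obj\<close>.\<close>

lemma cat_functor_full_subcategory:
  assumes "cat_functor C D Fo Fm" and "\<And>X. X \<in> Ob C \<Longrightarrow> P (Fo X)"
  shows "cat_functor C (full_subcategory D P) Fo Fm"
proof -
  interpret cat_functor C D Fo Fm by (rule assms)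
  show ?thesis
    by (intro cat_functor.intro category_full_subcategory C.category_axioms D.category_axioms
        cat_functor_axioms.intro)
      (auto simp: Fo_in_Ob Fm_in_Hom Fm_Ident Fm_Comp assms(2))
qed

theorem theorem3p6:
  fixes k :: "('k, 'r) ring_scheme"
  assumes "cring k"
  shows "cat_functor
      (Alg_wa k :: (('k, 'a) module \<times> ('a \<Rightarrow> 'k), 'a \<Rightarrow> 'a) category)
      (BFAlg_c k :: (('k, 'a) module \<times> ('a \<times> 'a \<Rightarrow> 'k), 'a \<Rightarrow> 'a) category)
      M_obj M_mor
    \<and> category_isomorphism
      (Alg_wa k :: (('k, 'a) module \<times> ('a \<Rightarrow> 'k), 'a \<Rightarrow> 'a) category)
      (full_subcategory (BFAlg_c k) (\<lambda>(A, b). normalised_form k A b))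
      M_obj M_mor N_obj N_mor"
proof (intro conjI category_isomorphism.intro category_isomorphism_axioms.intro
    cat_functor_M cat_functor_N cat_functor_full_subcategory)
  fix X :: "('k, 'a) module \<times> ('a \<Rightarrow> 'k)"
  assume X: "X \<in> Ob (Alg_wa k)"
  \<comment> \<open>This is the object condition for restricting the target of
    \<open>M_obj\<close>.\<close>
  then show "case M_obj X of (A, b) \<Rightarrow> normalised_form k A b"
    using normalised_form_M_obj by (cases X) (auto simp: M_obj_def)
  show "N_obj (M_obj X) = X"
    using X by (cases X) (simp add: N_obj_M_obj)
qed (auto simp: M_obj_N_obj M_mor_def N_mor_def)

end
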